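(* Let $m\ge 1$ and $\ell$ be integers and let $z$ be a nonzero complex number. Then the polynomial $$p(t)=(1+z^2)-z\,L_m(t,-1)$$ is the characteristic polynomial of the sequence $(A_n(2,m,\ell,z))_{n\ge 0}$, i.e. $p(N)A_n(2,m,\ell,z)=0$ for all integers $n\ge 0$.
   Context: For integers $n\ge 0$, $k\ge1$, $m\ge 1$, $\ell\in\mathbb{Z}$ and nonzero complex $z$, define $$A_n(k,m,\ell,z)=\sum_{h\in\mathbb{Z}}\binom{n}{\left\lfloor \frac{n+mh+\ell}{k}\right\rfloor}z^h,$$ where $\binom{n}{r}=0$ for $r<0$ or $r>n$ (so the sum is finite). The Lucas polynomials are defined by $L_0(x,s)=2$, $L_1(x,s)=x$ and $L_n(x,s)=xL_{n-1}(x,s)+sL_{n-2}(x,s)$ for $n\ge2$. $N$ denotes the shift operator on sequences, $N^iA_n=A_{n+i}$; for a polynomial $p(t)=\sum_i c_it^i$ one has $p(N)A_n=\sum_i c_iA_{n+i}$. Convention: a polynomial $p(t)$ is called the characteristic polynomial of a sequence $(f(n))_{n\ge 0}$ if $p(N)f(n)=0$ for all $n\ge 0$ (no minimality of the degree is required). *)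

theory Defs
  imports Complex_Main "HOL-Computational_Algebra.Polynomial" "HOL-Library.Groups_Big_Fun"
begin

definition int_choose :: "nat \<Rightarrow> int \<Rightarrow> nat" where
  "int_choose n r = (if r < 0 then 0 else n choose nat r)"

text \<open>
  Integer \<open>div\<close> rounds towards minus infinity, so it is the floor of the quotient also for
  negative arguments. \<open>Sum_any\<close> is the sum over all \<open>h :: int\<close> of a function with finite
  support, and \<open>0\<close> if the support is infinite; the latter does not happen for
  \<open>k \<ge> 1\<close> and \<open>m \<ge> 1\<close>, by \<open>finite_support_A\<close> below.
\<close>

definition A :: "nat \<Rightarrow> nat \<Rightarrow> nat \<Rightarrow> int \<Rightarrow> complex \<Rightarrow> complex" where
  "A n k m l z =
     Sum_any (\<lambda>h::int. of_nat (int_choose n ((int n + int m * h + l) div int k)) * z powi h)"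

fun lucas :: "nat \<Rightarrow> 'a::comm_ring_1 \<Rightarrow> 'a \<Rightarrow> 'a" where
  "lucas 0 x s = 2"
| "lucas (Suc 0) x s = x"
| "lucas (Suc (Suc n)) x s = x * lucas (Suc n) x s + s * lucas n x s"

text \<open>The sequence \<open>p(N) f\<close>, where \<open>N\<close> is the shift operator \<open>(N f) n = f (n + 1)\<close>.\<close>

definition poly_shift :: "complex poly \<Rightarrow> (nat \<Rightarrow> complex) \<Rightarrow> nat \<Rightarrow> complex" where
  "poly_shift p f n = (\<Sum>i\<le>degree p. coeff p i * f (n + i))"

text \<open>No minimality of the degree is required.\<close>

definition is_characteristic_poly :: "complex poly \<Rightarrow> (nat \<Rightarrow> complex) \<Rightarrow> bool" where
  "is_characteristic_poly p f \<longleftrightarrow> (\<forall>n. poly_shift p f n = 0)"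

lemma floor_eq_div_index:
  "\<lfloor>real_of_int (int n + int m * h + l) / real k\<rfloor> = (int n + int m * h + l) div int k"
  using floor_divide_of_int_eq[of "int n + int m * h + l" "int k", where 'a = real] by simp

lemma finite_support_A:
  assumes "k \<ge> 1" and "m \<ge> 1"
  shows "finite {h::int. of_nat (int_choose n ((int n + int m * h + l) div int k)) * z powi h
                   \<noteq> (0::complex)}"
proof -
  define g where "g h = int n + int m * h + l" for h
  have inj: "inj g"
    using assms(2) by (auto simp: g_def inj_on_def)
  have bound: "g h \<in> {0..<int k * (int n + 1)}"
    if "int_choose n (g h div int k) \<noteq> 0" for h
  proof -
    have r: "0 \<le> g h div int k" "g h div int k \<le> int n"
      using that by (auto simp: int_choose_def not_less split: if_splits)
    have "g h = int k * (g h div int k) + g h mod int k" by simp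
    moreover have "0 \<le> g h mod int k" "g h mod int k < int k"
      using assms(1) by auto
    moreover have "int k * (g h div int k) \<le> int k * int n" "0 \<le> int k * (g h div int k)"
      using r by (auto intro: mult_left_mono)
    ultimately show ?thesis
      unfolding atLeastLessThan_iff distrib_left by linarith
  qed
  have "finite (g -` {0..<int k * (int n + 1)})"
    by (rule finite_vimageI[OF finite_atLeastLessThan_int inj])
  moreover have "{h. of_nat (int_choose n (g h div int k)) * z powi h \<noteq> (0::complex)}
                 \<subseteq> g -` {0..<int k * (int n + 1)}"
  proof (rule subsetI)
    fix h assume "h \<in> {h. of_nat (int_choose n (g h div int k)) * z powi h \<noteq> (0::complex)}"
    then have "int_choose n (g h div int k) \<noteq> 0" by (metis (mono_tags, lifting) mem_Collect_eq mult_zero_left of_nat_0)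
    then show "h \<in> g -` {0..<int k * (int n + 1)}" unfolding vimage_eq by (rule bound)
  qed
  ultimately have "finite {h. of_nat (int_choose n (g h div int k)) * z powi h \<noteq> (0::complex)}"
    by (rule rev_finite_subset)
  then show ?thesis
    unfolding g_def .
qed

end

theory Submission
  imports Defs
begin

text \<open>
  Pascal's rule says that on \<open>a n x = int_choose n ((n + x) div 2)\<close> the shift \<open>N\<close> in \<open>n\<close> acts
  as \<open>E + 1/E\<close>, where \<open>E\<close> is the shift in \<open>x\<close>. As \<open>L_m(E + 1/E, -1) = E^m + 1/E^m\<close>, the
  operator \<open>L_m(N, -1)\<close> acts on \<open>A n 2 m l z\<close> as \<open>E^m + 1/E^m\<close> in \<open>l\<close>, and reindexing the
  sum over \<open>h\<close> shows that \<open>E^m\<close> acts as \<open>1/z\<close>.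
\<close>

text \<open>Coefficients above the degree vanish, so polynomials of different degrees can be summed
  over one common range.\<close>

lemma poly_shift_altdef:
  assumes "degree p \<le> d"
  shows "poly_shift p f n = (\<Sum>i\<le>d. coeff p i * f (n + i))"
  unfolding poly_shift_def
  by (rule sum.mono_neutral_left) (use assms in \<open>auto simp: not_le intro: coeff_eq_0\<close>)

lemma poly_shift_diff: "poly_shift (p - q) f n = poly_shift p f n - poly_shift q f n"
proof -
  define d where "d = max (degree p) (degree q)"
  have "degree p \<le> d" "degree q \<le> d" "degree (p - q) \<le> d"
    by (auto simp: d_def degree_diff_le_max)
  then show ?thesis
    by (simp add: poly_shift_altdef[of _ d] ring_distribs sum_subtractf)
qed

lemma poly_shift_smult: "poly_shift (smult c p) f n = c * poly_shift p f n"
  by (simp add: poly_shift_altdef[OF degree_smult_le] poly_shift_def sum_distrib_left mult.assoc)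

lemma poly_shift_const: "poly_shift [:c:] f n = c * f n"
  by (simp add: poly_shift_def)

lemma poly_shift_pCons_0: "poly_shift (pCons 0 p) f n = poly_shift p f (Suc n)"
  by (simp add: poly_shift_altdef[OF degree_pCons_le] poly_shift_def sum.atMost_Suc_shift
      del: sum.atMost_Suc)

lemma poly_shift_lucas:
  fixes f :: "nat \<Rightarrow> int \<Rightarrow> complex"
  assumes step: "\<And>n x. f (Suc n) x = f n (x + 1) + f n (x - 1)"
  shows "poly_shift (lucas m [:0, 1:] (- 1)) (\<lambda>n. f n x) n = f n (x + int m) + f n (x - int m)"
proof (induction m "[:0, 1:] :: complex poly" "- 1 :: complex poly"
    arbitrary: n rule: lucas.induct)
  case 1
  have "lucas 0 [:0, 1:] (- 1) = ([:2:] :: complex poly)"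
    by (simp add: numeral_poly)
  then show ?case
    by (simp only: poly_shift_const) simp
next
  case 2
  have "lucas (Suc 0) [:0, 1:] (- 1) = (pCons 0 [:1:] :: complex poly)"
    by simp
  then show ?case
    by (simp only: poly_shift_pCons_0 poly_shift_const) (simp add: step)
next
  case (3 m)
  have "lucas (Suc (Suc m)) [:0, 1:] (- 1) =
      pCons 0 (lucas (Suc m) [:0, 1:] (- 1)) - (lucas m [:0, 1:] (- 1) :: complex poly)"
    by simp
  \<comment> \<open>Applying \<open>step\<close> at \<open>x + int (Suc m)\<close> and
    \<open>x - int (Suc m)\<close> gives four terms; the two at \<open>x + int m\<close> and
    \<open>x - int m\<close> cancel against the subtracted \<open>lucas m\<close> part.\<close>
  then show ?case
    by (simp only: poly_shift_diff poly_shift_pCons_0 3) (simp add: step algebra_simps)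
qed

lemma int_choose_Suc: "int_choose (Suc n) r = int_choose n r + int_choose n (r - 1)"
proof (cases "r \<le> 0")
  case True
  then show ?thesis
    by (cases "r = 0") (auto simp: int_choose_def)
next
  case False
  then have "nat r = Suc (nat (r - 1))"
    by simp
  with False show ?thesis
    by (simp add: int_choose_def)
qed

lemma A_2_Suc:
  assumes "m \<ge> 1"
  shows "A (Suc n) 2 m l z = A n 2 m (l + 1) z + A n 2 m (l - 1) z"
proof -
  have "int_choose (Suc n) ((int (Suc n) + int m * h + l) div 2) =
      int_choose n ((int n + int m * h + (l + 1)) div 2) +
      int_choose n ((int n + int m * h + (l - 1)) div 2)" for h
  proof -
    \<comment> \<open>This needs \<open>k = 2\<close>: lowering the numerator by 2 lowers the floor
      by exactly 1, which matches the \<open>r - 1\<close> in Pascal's rule.\<close>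
    have "(int (Suc n) + int m * h + l) div 2 = (int n + int m * h + (l + 1)) div 2"
      "(int (Suc n) + int m * h + l) div 2 - 1 = (int n + int m * h + (l - 1)) div 2"
      by presburger+
    then show ?thesis
      by (simp only: int_choose_Suc)
  qed
  then show ?thesis
    \<comment> \<open>\<open>Sum_any\<close> is additive only when both supports are finite, since
      it defaults to 0 otherwise.\<close>
    using finite_support_A[of 2 m n "l + 1" z] finite_support_A[of 2 m n "l - 1" z] assms
    by (simp add: A_def Sum_any.distrib distrib_right)
qed

text \<open>Adding \<open>int m\<close> to \<open>l\<close> has the same effect on the binomial as
  replacing \<open>h\<close> by \<open>h + 1\<close>, and the factor \<open>z\<close> raises the
  power to match.\<close>

lemma A_add_period:
  assumes "k \<ge> 1" and "m \<ge> 1" and "z \<noteq> 0"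
  shows "z * A n k m (l + int m) z = A n k m l z"
proof -
  define g where "g h = of_nat (int_choose n ((int n + int m * h + l) div int k)) * z powi h" for h
  have "z * A n k m (l + int m) z =
      Sum_any (\<lambda>h. z * (of_nat (int_choose n ((int n + int m * h + (l + int m)) div int k)) * z powi h))"
    unfolding A_def by (rule Sum_any_right_distrib) (rule finite_support_A[OF assms(1,2)])
  also have "\<dots> = Sum_any (g \<circ> (\<lambda>h. h + 1))"
    using assms(3) by (simp add: g_def comp_def power_int_add algebra_simps)
  also have "\<dots> = Sum_any g"
    by (rule Sum_any.reindex_cong[symmetric, of "\<lambda>h. h + 1"])
      (auto simp: bij_def inj_def intro: surjI[of _ "\<lambda>h. h - 1"])
  finally show ?thesis
    by (simp add: A_def g_def)
qed

theorem theorem1: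
  fixes m :: nat and l :: int and z :: complex
  assumes "m \<ge> 1" and "z \<noteq> 0"
  shows "is_characteristic_poly
           ([:1 + z ^ 2:] - smult z (lucas m [:0, 1:] (- 1)))
           (\<lambda>n. A n 2 m l z)"
  unfolding is_characteristic_poly_def
proof
  fix n
  have "z * A n 2 m (l + int m) z = A n 2 m l z" "A n 2 m (l - int m) z = z * A n 2 m l z"
    using A_add_period[of 2 m z n l] A_add_period[of 2 m z n "l - int m"] assms by simp_all
  moreover have "poly_shift (lucas m [:0, 1:] (- 1)) (\<lambda>n. A n 2 m l z) n =
      A n 2 m (l + int m) z + A n 2 m (l - int m) z"
    by (rule poly_shift_lucas) (rule A_2_Suc[OF assms(1)])
  \<comment> \<open>Multiplied by \<open>z\<close>, the two shifted values become
    \<open>A n 2 m l z\<close> and \<open>z ^ 2 * A n 2 m l z\<close>, which cancel the constant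
    term.\<close>
  ultimately show "poly_shift ([:1 + z ^ 2:] - smult z (lucas m [:0, 1:] (- 1)))
      (\<lambda>n. A n 2 m l z) n = 0"
    by (simp add: poly_shift_diff poly_shift_smult poly_shift_const algebra_simps power2_eq_square)
qed

end
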